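(* Let $H = (V, E)$ be a hypergraph of arity $d$ with $N$ vertices and $M$ hyperedges, let $\beta \in [0,1]$, and let $t$ be a positive integer. Suppose that (1) $t$ divides $M$, (2) $1/t > \beta$, and (3) every vertex subset $V' \subseteq V$ fully contains at most $(|V'|/N)^d M + \beta M$ hyperedges. Let $\mathbf{P} \in \{0,1\}^{M \times N}$ be the indicator matrix of $H$. Then for all positive integers $q$, all $(t,q)$-legal subsets $E' \subseteq [M]^q$, and all $\delta \in [0,1]$: if $|E'| > \frac{M^q\delta^d}{(1 - \beta t)^q}$, then $|N^{(q)}_{\mathbf{P}}(E')| > N^q\delta$.
   Context: The indicator matrix of a hypergraph of arity $d$ with $N$ vertices and $M$ hyperedges is $\mathbf{P}\in\{0,1\}^{M\times N}$ with one column per vertex and one row per hyperedge, each row having $1$s exactly at the $d$ vertices of that hyperedge; a vertex subset fully contains a hyperedge if all its vertices lie in the subset. For $e\in[M]$, $N^{(1)}_{\mathbf{P}}(e)\subseteq[N]$ is the set of $d$ columns where row $e$ of $\mathbf{P}$ is nonzero. For $\mathbf{e}=(e_1,\dots,e_q)\in[M]^q$, $N^{(q)}_{\mathbf{P}}(\mathbf{e})=N^{(1)}_{\mathbf{P}}(e_1)\times\cdots\times N^{(1)}_{\mathbf{P}}(e_q)\subseteq[N]^q$ (the support of row $\mathbf{e}$ of $\mathbf{P}^{\otimes q}$), and for $E'\subseteq[M]^q$, $N^{(q)}_{\mathbf{P}}(E')=\bigcup_{\mathbf{e}\in E'}N^{(q)}_{\mathbf{P}}(\mathbf{e})$. A subset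 $E'\subseteq[M]^q$ is $(t,q)$-legal if for all $\ell\in[q]$ and all $e_1,\dots,e_{\ell-1},e_{\ell+1},\dots,e_q\in[M]$, the intersection $E'\cap\{(e_1,\dots,e_{\ell-1},e'_\ell,e_{\ell+1},\dots,e_q):e'_\ell\in[M]\}$ has cardinality either $0$ or at least $M/t$. *)

theory Defs
  imports Complex_Main "Jordan_Normal_Form.Matrix"
begin

definition hypergraph :: "'v set \<Rightarrow> 'v set set \<Rightarrow> nat \<Rightarrow> bool" where
  "hypergraph V E d \<longleftrightarrow> finite V \<and> (\<forall>h\<in>E. h \<subseteq> V \<and> card h = d)"

definition contained_edges :: "'v set set \<Rightarrow> 'v set \<Rightarrow> 'v set set" where
  "contained_edges E V' = {h \<in> E. h \<subseteq> V'}"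

(* The numbering of columns and rows is given by an enumeration vs of the vertices
   and an enumeration hs of the hyperedges. *)
definition indicator_mat :: "'v list \<Rightarrow> 'v set list \<Rightarrow> nat mat" where
  "indicator_mat vs hs =
     mat (length hs) (length vs) (\<lambda>(i, j). if vs ! j \<in> hs ! i then 1 else 0)"

(* [m]^q: the index set [m] is {0, ..., m - 1}, and a q-tuple is a list of length q. *)
definition tuples :: "nat \<Rightarrow> nat \<Rightarrow> nat list set" where
  "tuples m q = {xs. length xs = q \<and> set xs \<subseteq> {..<m}}"

definition nbr1 :: "nat mat \<Rightarrow> nat \<Rightarrow> nat set" where
  "nbr1 P e = {j. j < dim_col P \<and> P $$ (e, j) \<noteq> 0}"

(* listset [A1, ..., Aq] is the cartesian product A1 x ... x Aq; the exponent q of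
   the notation N^(q) is the length of the tuple. *)
definition nbr :: "nat mat \<Rightarrow> nat list \<Rightarrow> nat list set" where
  "nbr P es = listset (map (nbr1 P) es)"

definition nbr_set :: "nat mat \<Rightarrow> nat list set \<Rightarrow> nat list set" where
  "nbr_set P E' = (\<Union>es\<in>E'. nbr P es)"

(* The lists as and bs are (e_1, ..., e_{l-1}) and (e_{l+1}, ..., e_q), so l = length as + 1. *)
definition legal :: "nat \<Rightarrow> nat \<Rightarrow> nat \<Rightarrow> nat list set \<Rightarrow> bool" where
  "legal M t q E' \<longleftrightarrow> E' \<subseteq> tuples M q \<and>
     (\<forall>l\<in>{1..q}. \<forall>as\<in>tuples M (l - 1). \<forall>bs\<in>tuples M (q - l).
        (let S = E' \<inter> {as @ x # bs | x. x < M}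
         in card S = 0 \<or> real (card S) \<ge> real M / real t))"

end

(*
  Write r = M / (1 - beta t). For q = 1 legality gives |E'| \<ge> M / t, so the error term beta M is
  absorbed into beta t |E'| and |E'| \<le> r (|N(E')| / N)^d. The bound
  |E'| \<le> r^q (|N(E')| / N^q)^d tensorizes by induction on q: for a vertex v let F v be the set of
  tails of members of E' whose first hyperedge contains v. It is a union of legal slices, hence
  legal, and the F v cut N(E') into disjoint pieces. The fibres of E' over the tails are
  controlled by the case q = 1, and Minkowski's inequality in l^d, applied to the sum of the
  indicator functions of the F v, combines both estimates.
*)

theory Submission
  imports Defs "HOL-Analysis.Convex"
begin

section \<open>Convexity of powers and Minkowski's inequality for indicators\<close>

lemma convex_on_power_atLeast_0: "convex_on {0::real..} (\<lambda>x. x ^ n)"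
proof (cases "even n")
  case True
  then show ?thesis using convex_on_subset[OF convex_power_even, of n "{0..}"] by blast
next
  case False
  then show ?thesis by (rule convex_power_odd)
qed

text \<open>Minkowski's inequality for indicator functions, without \<open>d\<close>-th roots: \<open>a v\<close> stands for a bound on
  the \<open>l\<^sup>d\<close>-norm of the indicator of \<open>F v\<close>, up to the factor \<open>K powr (1 / d)\<close>. It is Jensen's inequality with
  weights proportional to \<open>a v\<close>.\<close>

lemma sum_power_card_le:
  fixes a :: "'a \<Rightarrow> real" and F :: "'a \<Rightarrow> 'b set"
  assumes fin: "finite V" "finite D" and F: "\<And>v. v \<in> V \<Longrightarrow> F v \<subseteq> D"
    and a: "\<And>v. v \<in> V \<Longrightarrow> 0 \<le> a v" and d: "0 < d"
    and le: "\<And>v. v \<in> V \<Longrightarrow> real (card (F v)) \<le> K * a v ^ d"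
  shows "(\<Sum>e\<in>D. real (card {v\<in>V. e \<in> F v}) ^ d) \<le> K * (\<Sum>v\<in>V. a v) ^ d"
proof -
  \<comment> \<open>Jensen is applied at the points \<open>1 / a v\<close>, so indices with
    \<open>a v = 0\<close> must go. Nothing is lost: since \<open>0 < d\<close>, such a
    \<open>v\<close> has \<open>card (F v) \<le> K * 0 ^ d = 0\<close>.\<close>
  define W where "W = {v\<in>V. 0 < a v}"
  define A where "A = (\<Sum>v\<in>W. a v)"
  have finW: "finite W" using fin by (simp add: W_def)
  have A_eq: "(\<Sum>v\<in>V. a v) = A"
    unfolding A_def W_def using fin a
    by (intro sum.mono_neutral_right) (auto simp: less_le)
  have in_W: "v \<in> W" if "v \<in> V" "e \<in> F v" for v e
  proof (rule ccontr)
    assume "v \<notin> W"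
    then have "a v = 0" using a[OF that(1)] that(1) by (auto simp: W_def)
    then have "card (F v) = 0" using le[OF that(1)] d by (simp add: power_0_left)
    then show False using finite_subset[OF F[OF that(1)] fin(2)] that(2) by auto
  qed
  then have count: "{v\<in>V. e \<in> F v} = {v\<in>W. e \<in> F v}" for e
    by (auto simp: W_def)
  show ?thesis
  proof (cases "W = {}")
    case True
    then show ?thesis using d by (simp add: A_eq count A_def power_0_left)
  next
    case False
    have A_pos: "0 < A" unfolding A_def using finW False by (intro sum_pos) (auto simp: W_def)
    have pos: "0 < a v" if "v \<in> W" for v using that by (simp add: W_def)
    have jensen: "real (card {v\<in>V. e \<in> F v}) ^ d
        \<le> A ^ d * (\<Sum>v\<in>W. a v / A * (of_bool (e \<in> F v) / a v ^ d))" for e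
    proof -
      have "real (card {v\<in>V. e \<in> F v}) = (\<Sum>v\<in>W. of_bool (e \<in> F v))"
        unfolding count using finW by (simp add: Collect_conj_eq Int_commute)
      \<comment> \<open>The count becomes \<open>A\<close> times a convex combination: the weights
        \<open>a v / A\<close> sum to 1 over \<open>W\<close>.\<close>
      also have "\<dots> = A * (\<Sum>v\<in>W. (a v / A) *\<^sub>R (of_bool (e \<in> F v) / a v))"
        unfolding sum_distrib_left using A_pos pos
        by (intro sum.cong) (auto dest: pos)
      finally have eq: "real (card {v\<in>V. e \<in> F v})
          = A * (\<Sum>v\<in>W. (a v / A) *\<^sub>R (of_bool (e \<in> F v) / a v))" .
      have "(\<Sum>v\<in>W. (a v / A) *\<^sub>R (of_bool (e \<in> F v) / a v)) ^ d
          \<le> (\<Sum>v\<in>W. a v / A * (of_bool (e \<in> F v) / a v) ^ d)"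
        using A_pos
        by (intro convex_on_sum[OF finW False convex_on_power_atLeast_0])
           (auto simp: A_def sum_divide_distrib[symmetric] dest: pos intro: less_imp_le)
      \<comment> \<open>An indicator equals its \<open>d\<close>-th power because
        \<open>0 < d\<close>.\<close>
      also have "\<dots> = (\<Sum>v\<in>W. a v / A * (of_bool (e \<in> F v) / a v ^ d))"
        using d by (intro sum.cong) (auto simp: power_divide)
      finally show ?thesis
        unfolding eq power_mult_distrib using A_pos by (simp add: mult_left_mono)
    qed
    have "(\<Sum>e\<in>D. real (card {v\<in>V. e \<in> F v}) ^ d)
        \<le> A ^ d * (\<Sum>e\<in>D. \<Sum>v\<in>W. a v / A * (of_bool (e \<in> F v) / a v ^ d))"
      unfolding sum_distrib_left[of "A ^ d" _ D] by (intro sum_mono jensen)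
    \<comment> \<open>After swapping the sums, summing the indicator over \<open>D\<close> yields
      \<open>card (F v)\<close>, and the assumed bound makes each quotient at most
      \<open>K\<close>.\<close>
    also have "\<dots> = A ^ d * (\<Sum>v\<in>W. a v / A * (real (card (F v)) / a v ^ d))"
    proof -
      have "(\<Sum>e\<in>D. a v / A * (of_bool (e \<in> F v) / a v ^ d))
          = a v / A * (real (card (F v)) / a v ^ d)" if "v \<in> W" for v
      proof -
        have "D \<inter> F v = F v" using F that by (auto simp: W_def)
        then show ?thesis
          using fin by (simp add: sum_distrib_left[symmetric] sum_divide_distrib[symmetric])
      qed
      then show ?thesis by (subst sum.swap) simp
    qed
    also have "\<dots> \<le> A ^ d * (\<Sum>v\<in>W. a v / A * K)"
    proof (intro mult_left_mono sum_mono)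
      fix v assume v: "v \<in> W"
      show "real (card (F v)) / a v ^ d \<le> K"
        using le[of v] v pos[OF v] by (simp add: W_def divide_le_eq)
      show "0 \<le> a v / A" using pos[OF v] A_pos by simp
    qed (use A_pos in simp)
    also have "\<dots> = K * A ^ d"
      using A_pos by (simp add: sum_distrib_right[symmetric] sum_divide_distrib[symmetric] A_def)
    finally show ?thesis by (simp add: A_eq)
  qed
qed

section \<open>Legal sets under slicing and union\<close>

lemma finite_tuples: "finite (tuples m q)"
  unfolding tuples_def using finite_lists_length_eq[of "{..<m}" q] by (simp add: conj_commute)

lemma Cons_in_tuples_iff: "x # es \<in> tuples m (Suc q) \<longleftrightarrow> x < m \<and> es \<in> tuples m q"
  by (auto simp: tuples_def)

lemma tuples_0: "tuples m 0 = {[]}"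
  by (auto simp: tuples_def)

lemma legal_subset: "legal M t q E' \<Longrightarrow> E' \<subseteq> tuples M q"
  by (simp add: legal_def)

lemma legalD:
  assumes "legal M t q E'" "Suc (length as + length bs) = q" "set as \<subseteq> {..<M}" "set bs \<subseteq> {..<M}"
  shows "card (E' \<inter> {as @ x # bs | x. x < M}) = 0
    \<or> real M / real t \<le> real (card (E' \<inter> {as @ x # bs | x. x < M}))"
proof -
  have "Suc (length as) \<in> {1..q}" "as \<in> tuples M (Suc (length as) - 1)"
    "bs \<in> tuples M (q - Suc (length as))"
    using assms by (auto simp: tuples_def)
  then show ?thesis using assms(1) unfolding legal_def Let_def by blast
qed

lemma legalI:
  assumes "E' \<subseteq> tuples M q"
    and "\<And>as bs. Suc (length as + length bs) = q \<Longrightarrow> set as \<subseteq> {..<M} \<Longrightarrow> set bs \<subseteq> {..<M} \<Longrightarrow>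
      card (E' \<inter> {as @ x # bs | x. x < M}) = 0
      \<or> real M / real t \<le> real (card (E' \<inter> {as @ x # bs | x. x < M}))"
  shows "legal M t q E'"
  unfolding legal_def Let_def by (intro conjI ballI assms) (auto simp: tuples_def)

text \<open>Prepending \<open>y\<close> maps a coordinate line of \<open>q\<close>-tuples
  bijectively onto a line of longer tuples with one more fixed entry. For \<open>y \<ge> M\<close>
  the slice is empty, so no bound on \<open>y\<close> has to be assumed.\<close>

lemma legal_slice:
  assumes "legal M t (Suc q) E'"
  shows "legal M t q {es. y # es \<in> E'}"
proof (cases "y < M")
  case True
  show ?thesis
  proof (rule legalI)
    show "{es. y # es \<in> E'} \<subseteq> tuples M q"
      using legal_subset[OF assms] by (auto simp: Cons_in_tuples_iff)
  next
    fix as bs :: "nat list"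
    assume *: "Suc (length as + length bs) = q" "set as \<subseteq> {..<M}" "set bs \<subseteq> {..<M}"
    have "E' \<inter> {(y # as) @ x # bs | x. x < M}
        = Cons y ` ({es. y # es \<in> E'} \<inter> {as @ x # bs | x. x < M})"
      by auto
    then have "card (E' \<inter> {(y # as) @ x # bs | x. x < M})
        = card ({es. y # es \<in> E'} \<inter> {as @ x # bs | x. x < M})"
      by (simp add: card_image)
    then show "card ({es. y # es \<in> E'} \<inter> {as @ x # bs | x. x < M}) = 0
      \<or> real M / real t \<le> real (card ({es. y # es \<in> E'} \<inter> {as @ x # bs | x. x < M}))"
      using legalD[OF assms, of "y # as" bs] * True by simp
  qed
next
  case False
  then have "{es. y # es \<in> E'} = {}"
    using legal_subset[OF assms] by (auto simp: Cons_in_tuples_iff)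
  then show ?thesis by (auto intro: legalI)
qed

text \<open>A line that meets the union meets some \<open>A i\<close>, and that member alone already
  supplies \<open>M / t\<close> points. \<open>I\<close> may be infinite; finiteness comes from
  \<open>tuples M q\<close>.\<close>

lemma legal_UN:
  assumes "\<And>i. i \<in> I \<Longrightarrow> legal M t q (A i)"
  shows "legal M t q (\<Union>i\<in>I. A i)"
proof (rule legalI)
  show sub: "(\<Union>i\<in>I. A i) \<subseteq> tuples M q"
    using legal_subset[OF assms] by blast
  fix as bs :: "nat list"
  assume *: "Suc (length as + length bs) = q" "set as \<subseteq> {..<M}" "set bs \<subseteq> {..<M}"
  let ?L = "{as @ x # bs | x. x < M}"
  have fin: "finite ((\<Union>i\<in>I. A i) \<inter> ?L)"
    using finite_subset[OF sub finite_tuples] by blast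
  show "card ((\<Union>i\<in>I. A i) \<inter> ?L) = 0 \<or> real M / real t \<le> real (card ((\<Union>i\<in>I. A i) \<inter> ?L))"
  proof (cases "(\<Union>i\<in>I. A i) \<inter> ?L = {}")
    case False
    then obtain i where i: "i \<in> I" "A i \<inter> ?L \<noteq> {}" by blast
    have le: "A i \<inter> ?L \<subseteq> (\<Union>i\<in>I. A i) \<inter> ?L" using i(1) by blast
    have "card (A i \<inter> ?L) \<noteq> 0"
      using i(2) unfolding card_0_eq[OF finite_subset[OF le fin]] .
    then have "real M / real t \<le> real (card (A i \<inter> ?L))"
      using legalD[OF assms[OF i(1)] *] by (elim disjE) (erule (1) notE | assumption)+
    also have "\<dots> \<le> real (card ((\<Union>i\<in>I. A i) \<inter> ?L))"
      using card_mono[OF fin le] by simp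
    finally show ?thesis ..
  qed simp
qed

section \<open>Splitting off the first coordinate\<close>

lemma nbr_Cons: "nbr P (e # es) = {v # vs | v vs. v \<in> nbr1 P e \<and> vs \<in> nbr P es}"
  by (auto simp: nbr_def set_Cons_def)

lemma nbr_subset_tuples: "nbr P es \<subseteq> tuples (dim_col P) (length es)"
proof (induction es)
  case Nil
  then show ?case by (simp add: nbr_def tuples_0)
next
  case (Cons e es)
  then show ?case by (auto simp: nbr_Cons Cons_in_tuples_iff nbr1_def)
qed

lemma nbr_set_subset_tuples:
  assumes "E' \<subseteq> tuples M q"
  shows "nbr_set P E' \<subseteq> tuples (dim_col P) q"
proof
  fix w assume "w \<in> nbr_set P E'"
  then obtain es where "es \<in> E'" "w \<in> nbr P es" by (auto simp: nbr_set_def)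
  moreover from this have "length es = q" using assms by (auto simp: tuples_def)
  ultimately show "w \<in> tuples (dim_col P) q" using nbr_subset_tuples by blast
qed

text \<open>Sorting the neighbours by their first vertex \<open>v\<close> collects the tails over
  every \<open>x\<close> whose hyperedge contains \<open>v\<close>. An index \<open>x\<close>
  outside the range of rows contributes an empty slice.\<close>

lemma nbr_set_split:
  assumes "E' \<subseteq> tuples M (Suc q)"
  shows "nbr_set P E'
    = (\<Union>v<dim_col P. Cons v ` nbr_set P (\<Union>x\<in>{x. v \<in> nbr1 P x}. {es. x # es \<in> E'}))"
    (is "_ = (\<Union>v<_. Cons v ` nbr_set P (?F v))")
proof (intro equalityI subsetI)
  fix w assume "w \<in> nbr_set P E'"
  then obtain es where es: "es \<in> E'" "w \<in> nbr P es" unfolding nbr_set_def by blast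
  obtain x es' where x: "es = x # es'"
    using assms es(1) by (cases es) (auto simp: tuples_def)
  obtain v ws where v: "v \<in> nbr1 P x" "ws \<in> nbr P es'" "w = v # ws"
    using es(2) unfolding x nbr_Cons by blast
  have "es' \<in> ?F v" using v(1) es(1) unfolding x by blast
  then have "ws \<in> nbr_set P (?F v)" using v(2) unfolding nbr_set_def by (rule UN_I)
  moreover have "v < dim_col P" using v(1) by (simp add: nbr1_def)
  ultimately show "w \<in> (\<Union>v<dim_col P. Cons v ` nbr_set P (?F v))"
    unfolding v(3) by (intro UN_I[of v] imageI) simp_all
next
  fix w assume "w \<in> (\<Union>v<dim_col P. Cons v ` nbr_set P (?F v))"
  then obtain v ws where v: "ws \<in> nbr_set P (?F v)" "w = v # ws" by (elim UN_E imageE)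
  then obtain x es where es: "ws \<in> nbr P es" "v \<in> nbr1 P x" "x # es \<in> E'"
    unfolding nbr_set_def by (elim UN_E CollectE)
  then have "w \<in> nbr P (x # es)" unfolding v(2) nbr_Cons by blast
  with es(3) show "w \<in> nbr_set P E'" unfolding nbr_set_def by (rule UN_I)
qed

lemma card_nbr_set_split:
  assumes "E' \<subseteq> tuples M (Suc q)"
  shows "card (nbr_set P E')
    = (\<Sum>v<dim_col P. card (nbr_set P (\<Union>x\<in>{x. v \<in> nbr1 P x}. {es. x # es \<in> E'})))"
proof -
  have "finite (nbr_set P (\<Union>x\<in>{x. v \<in> nbr1 P x}. {es. x # es \<in> E'}))" for v
  proof -
    have "(\<Union>x\<in>{x. v \<in> nbr1 P x}. {es. x # es \<in> E'}) \<subseteq> tuples M q"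
      using assms by (auto simp: Cons_in_tuples_iff)
    from nbr_set_subset_tuples[OF this] show ?thesis
      using finite_tuples finite_subset by blast
  qed
  then show ?thesis
    unfolding nbr_set_split[OF assms]
    by (subst card_UN_disjoint) (auto simp: card_image)
qed

text \<open>Here the grouping is by tails, whereas neighbours are grouped by first entries; the
  induction plays the two decompositions against each other.\<close>

lemma card_tuples_split:
  assumes "E' \<subseteq> tuples M (Suc q)"
  shows "card E' = (\<Sum>es\<in>tuples M q. card {x. x # es \<in> E'})"
proof -
  have fin: "finite {x. x # es \<in> E'}" for es
    by (rule finite_subset[of _ "{..<M}"]) (use assms in \<open>auto simp: Cons_in_tuples_iff\<close>)
  have "E' = (\<Union>es\<in>tuples M q. (\<lambda>x. x # es) ` {x. x # es \<in> E'})" (is "_ = ?r")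
  proof
    show "E' \<subseteq> ?r"
    proof
      fix w assume w: "w \<in> E'"
      with assms obtain x es where "w = x # es" by (cases w) (auto simp: tuples_def)
      with w assms show "w \<in> ?r"
        by (intro UN_I[of es]) (auto simp: Cons_in_tuples_iff)
    qed
  qed auto
  then have "card E' = card ?r" by (rule arg_cong)
  also have "\<dots> = (\<Sum>es\<in>tuples M q. card {x. x # es \<in> E'})"
    using fin finite_tuples by (subst card_UN_disjoint) (auto simp: card_image inj_on_def)
  finally show ?thesis .
qed

section \<open>Tensorization of the one-coordinate bound\<close>

text \<open>\<open>single\<close> is the case of one coordinate, phrased for sets of row indices.
  Everything about the hypergraph enters through it, and each further coordinate costs one factor
  \<open>r\<close>.\<close>

lemma card_legal_le:
  fixes P :: "nat mat" and r :: real
  defines "N \<equiv> dim_col P"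
  assumes d: "0 < d" and r: "0 \<le> r"
    and single: "\<And>S. S \<subseteq> {..<M} \<Longrightarrow> card S = 0 \<or> real M / real t \<le> real (card S) \<Longrightarrow>
      real (card S) \<le> r * (real (card (\<Union>e\<in>S. nbr1 P e)) / real N) ^ d"
  shows "legal M t q E' \<Longrightarrow>
    real (card E') \<le> r ^ q * (real (card (nbr_set P E')) / real N ^ q) ^ d"
proof (induction q arbitrary: E')
  case 0
  then have "E' = {} \<or> E' = {[]}" using legal_subset[OF 0] by (simp add: tuples_0 subset_singleton_iff)
  then show ?case using d by (auto simp: nbr_set_def nbr_def)
next
  case (Suc q)
  note sub = legal_subset[OF Suc.prems]
  define F where "F v = (\<Union>x\<in>{x. v \<in> nbr1 P x}. {es. x # es \<in> E'})" for v
  define U where "U es = (\<Union>x\<in>{x. x # es \<in> E'}. nbr1 P x)" for es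
  have legal_F: "legal M t q (F v)" for v
    unfolding F_def using legal_slice[OF Suc.prems] by (intro legal_UN)
  \<comment> \<open>The incidence between vertices and tails read from the other side:
    \<open>card (U es)\<close> counts the sets \<open>F v\<close> containing \<open>es\<close>,
    which is the quantity in \<open>sum_power_card_le\<close>.\<close>
  have U_eq: "U es = {v\<in>{..<N}. es \<in> F v}" for es
    by (auto simp: U_def F_def nbr1_def N_def)
  have fibre: "real (card {x. x # es \<in> E'}) \<le> r * (real (card (U es)) / real N) ^ d"
    if "es \<in> tuples M q" for es
  proof -
    \<comment> \<open>The fibre over \<open>es\<close> is a line in the first direction, so legality
      bounds its size from below.\<close>
    have "E' \<inter> {[] @ x # es | x. x < M} = (\<lambda>x. x # es) ` {x. x # es \<in> E'}"
      using sub by (auto simp: Cons_in_tuples_iff)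
    then have "card (E' \<inter> {[] @ x # es | x. x < M}) = card {x. x # es \<in> E'}"
      by (simp add: card_image inj_on_def)
    then have "card {x. x # es \<in> E'} = 0 \<or> real M / real t \<le> real (card {x. x # es \<in> E'})"
      using legalD[OF Suc.prems, of "[]" es] that by (simp add: tuples_def)
    moreover have "{x. x # es \<in> E'} \<subseteq> {..<M}"
      using sub by (auto simp: Cons_in_tuples_iff)
    ultimately show ?thesis unfolding U_def by (rule single[rotated])
  qed
  have "real (card E') = (\<Sum>es\<in>tuples M q. real (card {x. x # es \<in> E'}))"
    by (simp add: card_tuples_split[OF sub])
  also have "\<dots> \<le> (\<Sum>es\<in>tuples M q. r * (real (card (U es)) / real N) ^ d)"
    by (intro sum_mono fibre)
  also have "\<dots> = r * (\<Sum>es\<in>tuples M q. real (card (U es)) ^ d) / real N ^ d"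
    by (simp add: sum_distrib_left sum_divide_distrib power_divide)
  also have "\<dots> \<le> r * (r ^ q * (\<Sum>v<N. real (card (nbr_set P (F v))) / real N ^ q) ^ d) / real N ^ d"
  proof -
    \<comment> \<open>Minkowski with \<open>K = r ^ q\<close> and \<open>a v\<close> the density of
      \<open>nbr_set P (F v)\<close>; the induction hypothesis for \<open>F v\<close> is the
      required bound.\<close>
    have "(\<Sum>es\<in>tuples M q. real (card (U es)) ^ d)
        \<le> r ^ q * (\<Sum>v<N. real (card (nbr_set P (F v))) / real N ^ q) ^ d"
      unfolding U_eq
      by (rule sum_power_card_le)
         (use d finite_tuples legal_subset[OF legal_F] Suc.IH[OF legal_F] in simp_all)
    then show ?thesis using r by (intro divide_right_mono mult_left_mono) auto
  qed
  also have "(\<Sum>v<N. real (card (nbr_set P (F v))) / real N ^ q)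
      = real (card (nbr_set P E')) / real N ^ q"
    by (simp add: card_nbr_set_split[OF sub] F_def N_def sum_divide_distrib)
  finally show ?case
    by (simp add: power_divide power_mult_distrib mult_ac)
qed

section \<open>From columns of the matrix back to vertices\<close>

lemma nbr1_indicator_mat:
  assumes "e < length hs"
  shows "nbr1 (indicator_mat vs hs) e = {j. j < length vs \<and> vs ! j \<in> hs ! e}"
  using assms by (auto simp: nbr1_def indicator_mat_def split: if_splits)

text \<open>\<open>V'\<close> is the set of vertices numbered by the neighbouring columns. It
  contains every hyperedge numbered by \<open>S\<close>, and distinctness of \<open>vs\<close> and
  \<open>hs\<close> makes both numberings preserve cardinality.\<close>

lemma card_le_contained_edges:
  assumes vs: "distinct vs" and hs: "distinct hs" "\<And>h. h \<in> set hs \<Longrightarrow> h \<subseteq> set vs"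
    and S: "S \<subseteq> {..<length hs}"
  obtains V' where "V' \<subseteq> set vs" "card V' = card (\<Union>e\<in>S. nbr1 (indicator_mat vs hs) e)"
    "card S \<le> card (contained_edges (set hs) V')"
proof
  let ?J = "\<Union>e\<in>S. nbr1 (indicator_mat vs hs) e"
  have J: "?J = {j. j < length vs \<and> (\<exists>e\<in>S. vs ! j \<in> hs ! e)}"
    using S by (auto simp: nbr1_indicator_mat subset_iff)
  show "nth vs ` ?J \<subseteq> set vs" unfolding J by auto
  show "card (nth vs ` ?J) = card ?J"
    unfolding J using vs by (intro card_image) (auto simp: inj_on_def nth_eq_iff_index_eq)
  have "nth hs ` S \<subseteq> contained_edges (set hs) (nth vs ` ?J)"
  proof
    fix h assume "h \<in> nth hs ` S"
    then obtain e where e: "e \<in> S" "h = hs ! e" by blast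
    then have h: "h \<in> set hs" using S by auto
    have "h \<subseteq> nth vs ` ?J"
    proof
      fix v assume v: "v \<in> h"
      then obtain j where "j < length vs" "vs ! j = v"
        using hs(2)[OF h] by (metis in_set_conv_nth subsetD)
      with v e show "v \<in> nth vs ` ?J" unfolding J by blast
    qed
    with h show "h \<in> contained_edges (set hs) (nth vs ` ?J)"
      by (simp add: contained_edges_def)
  qed
  then have "card (nth hs ` S) \<le> card (contained_edges (set hs) (nth vs ` ?J))"
    by (intro card_mono) (auto simp: contained_edges_def)
  moreover have "card (nth hs ` S) = card S"
    using S hs(1) by (intro card_image) (auto simp: inj_on_def nth_eq_iff_index_eq subset_iff)
  ultimately show "card S \<le> card (contained_edges (set hs) (nth vs ` ?J))" by simp
qed

theorem theorem4p9:
  fixes V :: "'v set" and E :: "'v set set" and d N M t :: nat and \<beta> :: real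
    and vs :: "'v list" and hs :: "'v set list" and P :: "nat mat"
  assumes "hypergraph V E d" and "card V = N" and "card E = M"
    and "0 \<le> \<beta>" and "\<beta> \<le> 1" and "t > 0"
    and "t dvd M"
    and "1 / real t > \<beta>"
    and "\<And>V'. V' \<subseteq> V \<Longrightarrow>
           real (card (contained_edges E V')) \<le> (real (card V') / real N) ^ d * real M + \<beta> * real M"
    and "distinct vs" and "set vs = V" and "distinct hs" and "set hs = E"
    and "P = indicator_mat vs hs"
  shows "\<forall>q>0. \<forall>E'. legal M t q E' \<longrightarrow>
           (\<forall>\<delta>\<in>{0..1::real}.
              real (card E') > real M ^ q * \<delta> ^ d / (1 - \<beta> * real t) ^ q \<longrightarrow>
              real (card (nbr_set P E')) > real N ^ q * \<delta>)"
proof (intro allI impI ballI)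
  fix q :: nat and E' and \<delta> :: real
  assume q: "0 < q" and legal: "legal M t q E'" and \<delta>: "\<delta> \<in> {0..1}"
    and large: "real (card E') > real M ^ q * \<delta> ^ d / (1 - \<beta> * real t) ^ q"
  define r where "r = real M / (1 - \<beta> * real t)"
  define n where "n = card (nbr_set P E')"
  have c: "0 < 1 - \<beta> * real t" "1 - \<beta> * real t \<le> 1"
    using assms(4,6,8) by (auto simp: field_simps)
  then have r: "0 \<le> r" "real M \<le> r"
    using mult_left_mono[of "1 - \<beta> * real t" 1 "real M"] by (auto simp: r_def le_divide_eq)
  have len: "length vs = N" "length hs = M"
    using assms(2,3,10-13) distinct_card[of vs] distinct_card[of hs] by auto
  then have N: "dim_col P = N" using assms(14) by (simp add: indicator_mat_def)
  have large': "r ^ q * \<delta> ^ d < real (card E')"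
    using large by (simp add: r_def power_divide)
  have "card E' \<le> card (tuples M q)"
    by (intro card_mono finite_tuples legal_subset[OF legal])
  also have "card (tuples M q) = M ^ q"
    unfolding tuples_def using card_lists_length_eq[of "{..<M}" q] by (simp add: conj_commute)
  finally have trivial_le: "real (card E') \<le> real M ^ q"
    by (simp flip: of_nat_power)
  \<comment> \<open>For \<open>d = 0\<close> the factor \<open>\<delta> ^ d\<close> is 1, even at
    \<open>\<delta> = 0\<close>, and \<open>E'\<close> would have more than
    \<open>r ^ q \<ge> M ^ q\<close> members.\<close>
  have d: "0 < d"
  proof (rule ccontr)
    assume "\<not> 0 < d"
    then have "r ^ q < real (card E')" using large' by simp
    moreover have "real M ^ q \<le> r ^ q" using r by (intro power_mono) auto
    ultimately show False using trivial_le by simp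
  qed
  have M: "0 < M"
  proof (rule ccontr)
    assume "\<not> 0 < M"
    then show False using large' trivial_le q by (simp add: r_def power_0_left)
  qed
  \<comment> \<open>Since \<open>M\<close> and \<open>d\<close> are positive, some hyperedge is
    nonempty. Positivity of \<open>N\<close> is needed for the final multiplication by
    \<open>N ^ q\<close>.\<close>
  have "0 < N"
  proof (rule ccontr)
    assume "\<not> 0 < N"
    then have "V = {}" using assms(1,2) by (auto simp: hypergraph_def)
    moreover obtain h where "h \<in> E" using M assms(3) by fastforce
    ultimately show False using assms(1) d by (auto simp: hypergraph_def)
  qed
  have single: "real (card S) \<le> r * (real (card (\<Union>e\<in>S. nbr1 P e)) / real (dim_col P)) ^ d"
    if S: "S \<subseteq> {..<M}" and card_S: "card S = 0 \<or> real M / real t \<le> real (card S)" for S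
  proof (cases "card S = 0")
    case True
    then show ?thesis using r by simp
  next
    case False
    obtain V' where V': "V' \<subseteq> V" "card V' = card (\<Union>e\<in>S. nbr1 P e)"
      "card S \<le> card (contained_edges E V')"
    proof (rule card_le_contained_edges[of vs hs S])
      show "h \<subseteq> set vs" if "h \<in> set hs" for h
        using that assms(1,11,13) by (auto simp: hypergraph_def)
      show "S \<subseteq> {..<length hs}" using S len by simp
    qed (use assms(10-14) in auto)
    have "real (card S) \<le> real (card (contained_edges E V'))" using V'(3) by simp
    also have "\<dots> \<le> (real (card V') / real N) ^ d * real M + \<beta> * real M"
      using V'(1) by (rule assms(9))
    \<comment> \<open>The lower bound \<open>M / t\<close> on a nonempty line turns the additive
      error into a multiple of \<open>card S\<close>, which moves to the left side.\<close>
    also have "\<beta> * real M \<le> \<beta> * (real t * real (card S))"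
      using card_S False assms(4,6) by (intro mult_left_mono) (auto simp: divide_le_eq mult.commute)
    finally have "(1 - \<beta> * real t) * real (card S) \<le> (real (card V') / real N) ^ d * real M"
      by (simp add: algebra_simps)
    then show ?thesis
      using c by (simp add: r_def N V'(2) pos_le_divide_eq mult.commute)
  qed
  have "r ^ q * \<delta> ^ d < r ^ q * (real n / real N ^ q) ^ d"
    using large' card_legal_le[OF d r(1) single legal] by (simp add: N n_def)
  \<comment> \<open>Strictness lets \<open>r ^ q\<close> be cancelled knowing only
    \<open>0 \<le> r\<close>.\<close>
  then have "\<delta> ^ d < (real n / real N ^ q) ^ d"
    using r by (auto elim: mult_left_less_imp_less)
  then have "\<delta> < real n / real N ^ q"
    by (rule power_less_imp_less_base) simp
  then show "real N ^ q * \<delta> < real (card (nbr_set P E'))"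
    using \<open>0 < N\<close> by (simp add: n_def less_divide_eq mult.commute)
qed

end
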